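(* Let $A$ be a unitary operator on $n+1$ qubits with $$A|0\rangle_{n+1}=\cos\theta\,|\psi_0\rangle_n|0\rangle+\sin\theta\,|\psi_1\rangle_n|1\rangle,$$ where $|\psi_0\rangle_n,|\psi_1\rangle_n$ are normalized $n$-qubit states and $\theta$ is an unknown parameter to be estimated. Put $$U_0=-\mathbf{I}_{n+1}+2|0\rangle_{n+1}\langle0|_{n+1},\quad U_f=-\mathbf{I}_{n+1}+2\,\mathbf{I}_n\otimes|0\rangle\langle0|,\quad G=AU_0A^\dagger U_f,\quad Q=U_0A^\dagger U_fA,$$ and consider the noiseless states, written as functions of the number $N_{\mathrm q}$ of uses of $A$ and $A^\dagger$, $$|\psi_G(\theta,N_{\mathrm q})\rangle=\cos(N_{\mathrm q}\theta)|\psi_0\rangle_n|0\rangle+\sin(N_{\mathrm q}\theta)|\psi_1\rangle_n|1\rangle,$$ $$|\psi_Q(\theta,N_{\mathrm q})\rangle=\cos(N_{\mathrm q}\theta)|0\rangle_{n+1}+\sin(N_{\mathrm q}\theta)|\phi\rangle_{n+1},$$ $$|\phi\rangle_{n+1}=A^\dagger\left(-\sin\theta|\psi_0\rangle_n|0\rangle+\cos\theta|\psi_1\rangle_n|1\rangle\right),$$ where $|\psi_G(\theta,N_{\mathrm q})\rangle=G^mA|0\rangle_{n+1}$ for $N_{\mathrm q}=2m+1$ and $|\psi_Q(\theta,N_{\mathrm q})\rangle=Q^m|0\rangle_{n+1}$ for $N_{\mathrm q}=2m$. Let $F_{\mathrm q,G}(\theta,N_{\mathrm q})$ and $F_{\mathrm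 q,Q}(\theta,N_{\mathrm q})$ be the quantum Fisher information about $\theta$ of these two states. Let $F_{\mathrm c,G}(\theta,N_{\mathrm q})$ be the classical Fisher information about $\theta$ of the outcome distribution obtained by measuring $|\psi_G(\theta,N_{\mathrm q})\rangle$ with $E_{G,0}=\mathbf{I}_n\otimes|0\rangle\langle0|$, $E_{G,1}=\mathbf{I}_n\otimes|1\rangle\langle1|$, and let $F_{\mathrm c,Q}(\theta,N_{\mathrm q})$ be that obtained by measuring $|\psi_Q(\theta,N_{\mathrm q})\rangle$ with $E_{Q,0}=|0\rangle_{n+1}\langle0|_{n+1}$, $E_{Q,1}=\mathbf{I}_{n+1}-E_{Q,0}$. Then $$F_{\mathrm c,G}(\theta,N_{\mathrm q})=F_{\mathrm q,G}(\theta,N_{\mathrm q})=F_{\mathrm c,Q}(\theta,N_{\mathrm q})=F_{\mathrm q,Q}(\theta,N_{\mathrm q})=4N_{\mathrm q}^2;$$ in particular all four quantities are independent of the unknown parameter $\theta$.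
   Context: $\mathbf{I}_k$ is the identity on $k$ qubits; $|0\rangle_{n+1}$ is the all-zero computational basis state. The classical Fisher information of a distribution $p(i;\theta)=\mathrm{Tr}(\rho(\theta)E_i)$, $i\in\{0,1\}$, is $\sum_i\left(\partial_\theta\ln p(i;\theta)\right)^2p(i;\theta)$. The quantum Fisher information of a family of states $\rho(\theta)$ is $\mathrm{Tr}(\rho(\theta)L^2)$, where $L$ is the symmetric logarithmic derivative, i.e. the Hermitian operator with $\partial_\theta\rho=\frac12(\rho L+L\rho)$; for a pure state $|\psi(\theta)\rangle$ it is given by $4\left(\langle\dot\psi|\dot\psi\rangle-|\langle\dot\psi|\psi\rangle|^2\right)$, the dot denoting $\partial/\partial\theta$. The states are regarded as functions of a general number of queries $N_{\mathrm q}$, although actual values are odd for $G$ and even for $Q$.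
   Formalization: The kets ψ0, ψ1 and φ are held fixed when differentiating in θ (if φ varies with θ through A, the quantum Fisher information for Q can exceed 4N²); where an outcome probability vanishes, the classical Fisher summand is read as its limit. *)

theory Defs
  imports "HOL-Analysis.Analysis"
begin

text \<open>
  A computational basis state of \<open>n\<close> qubits is a bit string, i.e. an element of \<^typ>\<open>bool ^ 'n\<close> with
  \<open>n = CARD('n)\<close>; \<^const>\<open>False\<close> is the bit 0. The \<open>n + 1\<close> qubits are the \<open>n\<close>-qubit register followed
  by one more qubit, so their basis is \<^typ>\<open>(bool ^ 'n) \<times> bool\<close>.
\<close>

type_synonym 'i ket = "complex ^ 'i"
type_synonym 'i oper = "complex ^ 'i ^ 'i"
type_synonym 'n reg = "(bool ^ 'n)"
type_synonym 'n reg1 = "(bool ^ 'n) \<times> bool"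

definition adj :: "complex ^ 'i ^ 'j \<Rightarrow> complex ^ 'j ^ 'i" where
  "adj M = (\<chi> i j. cnj (M $ j $ i))"

definition hermitian :: "('i::finite) oper \<Rightarrow> bool" where
  "hermitian M \<longleftrightarrow> adj M = M"

definition unitary :: "('i::finite) oper \<Rightarrow> bool" where
  "unitary M \<longleftrightarrow> adj M ** M = mat 1 \<and> M ** adj M = mat 1"

definition ketbra :: "('i::finite) ket \<Rightarrow> 'i ket \<Rightarrow> 'i oper" where
  "ketbra u v = (\<chi> i j. u $ i * cnj (v $ j))"

definition tensor_ket :: "('i::finite) ket \<Rightarrow> ('j::finite) ket \<Rightarrow> ('i \<times> 'j) ket"
    (infixr \<open>\<otimes>\<^sub>k\<close> 75) where
  "u \<otimes>\<^sub>k v = (\<chi> p. u $ fst p * v $ snd p)"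

definition tensor_op :: "('i::finite) oper \<Rightarrow> ('j::finite) oper \<Rightarrow> ('i \<times> 'j) oper"
    (infixr \<open>\<otimes>\<^sub>o\<close> 75) where
  "M \<otimes>\<^sub>o K = (\<chi> p q. M $ fst p $ fst q * K $ snd p $ snd q)"

definition ket :: "'i::finite \<Rightarrow> 'i ket" where
  "ket i = axis i 1"

definition ket_zero :: "('n::finite) reg1 ket" where
  "ket_zero = ket ((\<chi> k. False), False)"

definition U0 :: "('n::finite) reg1 oper" where
  "U0 = - mat 1 + 2 *\<^sub>R ketbra ket_zero ket_zero"

definition Uf :: "('n::finite) reg1 oper" where
  "Uf = - mat 1 + 2 *\<^sub>R (mat 1 \<otimes>\<^sub>o ketbra (ket False) (ket False))"

definition grover_G :: "('n::finite) reg1 oper \<Rightarrow> 'n reg1 oper" where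
  "grover_G A = A ** U0 ** adj A ** Uf"

definition grover_Q :: "('n::finite) reg1 oper \<Rightarrow> 'n reg1 oper" where
  "grover_Q A = U0 ** adj A ** Uf ** A"

text \<open>
  The parameter \<open>\<theta>\<close>, in which the Fisher informations differentiate, enters the two families only
  through the amplitudes; the kets \<open>\<psi>0\<close>, \<open>\<psi>1\<close> and \<open>\<phi>\<close> do not vary with it.
\<close>

definition psi_G :: "('n::finite) reg ket \<Rightarrow> 'n reg ket \<Rightarrow> nat \<Rightarrow> real \<Rightarrow> 'n reg1 ket" where
  "psi_G \<psi>0 \<psi>1 N \<theta> =
     cos (real N * \<theta>) *\<^sub>R (\<psi>0 \<otimes>\<^sub>k ket False) + sin (real N * \<theta>) *\<^sub>R (\<psi>1 \<otimes>\<^sub>k ket True)"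

definition psi_Q :: "('n::finite) reg1 ket \<Rightarrow> nat \<Rightarrow> real \<Rightarrow> 'n reg1 ket" where
  "psi_Q \<phi> N \<theta> = cos (real N * \<theta>) *\<^sub>R ket_zero + sin (real N * \<theta>) *\<^sub>R \<phi>"

definition E_G :: "bool \<Rightarrow> ('n::finite) reg1 oper" where
  "E_G b = mat 1 \<otimes>\<^sub>o ketbra (ket b) (ket b)"

definition E_Q :: "bool \<Rightarrow> ('n::finite) reg1 oper" where
  "E_Q b = (if b then mat 1 - ketbra ket_zero ket_zero else ketbra ket_zero ket_zero)"

definition density_op :: "('i::finite) ket \<Rightarrow> 'i oper" where
  "density_op \<psi> = ketbra \<psi> \<psi>"

definition outcome_prob :: "(real \<Rightarrow> ('i::finite) oper) \<Rightarrow> 'i oper \<Rightarrow> real \<Rightarrow> real" where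
  "outcome_prob \<rho> E \<theta> = Re (trace (\<rho> \<theta> ** E))"

text \<open>
  The summand \<open>(\<partial>\<^sub>\<theta> ln p)\<^sup>2 p\<close> of the classical Fisher information. Where \<open>p = 0\<close> the expression is
  undefined (of the form \<open>\<infinity> \<cdot> 0\<close>) and stands for its limit.
\<close>

definition fisher_expr :: "(real \<Rightarrow> real) \<Rightarrow> real \<Rightarrow> real" where
  "fisher_expr p \<theta> = (deriv (\<lambda>t. ln (p t)) \<theta>)\<^sup>2 * p \<theta>"

definition fisher_term :: "(real \<Rightarrow> real) \<Rightarrow> real \<Rightarrow> real" where
  "fisher_term p \<theta> = (if p \<theta> = 0 then Lim (at \<theta>) (fisher_expr p) else fisher_expr p \<theta>)"

definition classical_fisher ::
    "(real \<Rightarrow> ('i::finite) oper) \<Rightarrow> (bool \<Rightarrow> 'i oper) \<Rightarrow> real \<Rightarrow> real" where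
  "classical_fisher \<rho> E \<theta> = (\<Sum>i\<in>UNIV. fisher_term (outcome_prob \<rho> (E i)) \<theta>)"

definition is_SLD :: "(real \<Rightarrow> ('i::finite) oper) \<Rightarrow> real \<Rightarrow> 'i oper \<Rightarrow> bool" where
  "is_SLD \<rho> \<theta> L \<longleftrightarrow> hermitian L \<and>
     (\<rho> has_vector_derivative (1/2) *\<^sub>R (\<rho> \<theta> ** L + L ** \<rho> \<theta>)) (at \<theta>)"

text \<open>
  For a non-invertible \<open>\<rho>\<close> (in particular a pure state) \<open>L\<close> is not unique, but \<open>Tr(\<rho> L\<^sup>2)\<close> does not
  depend on the choice: lemma \<open>quantum_fisher_eq\<close>.
\<close>

definition quantum_fisher :: "(real \<Rightarrow> ('i::finite) oper) \<Rightarrow> real \<Rightarrow> real" where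
  "quantum_fisher \<rho> \<theta> = (let L = (SOME L. is_SLD \<rho> \<theta> L) in Re (trace (\<rho> \<theta> ** (L ** L))))"

lemma matrix_matrix_add_right_distrib:
  fixes X Y M :: "('i::finite) oper"
  shows "(X + Y) ** M = X ** M + Y ** M"
  by (simp add: matrix_matrix_mult_def vec_eq_iff sum.distrib distrib_right)

lemma SLD_trace_unique:
  fixes \<rho> :: "real \<Rightarrow> ('i::finite) oper"
  assumes "is_SLD \<rho> \<theta> L" "is_SLD \<rho> \<theta> K"
  shows "trace (\<rho> \<theta> ** (L ** L)) = trace (\<rho> \<theta> ** (K ** K))"
proof -
  let ?R = "\<rho> \<theta>"
  have "(1/2) *\<^sub>R (?R ** L + L ** ?R) = (1/2) *\<^sub>R (?R ** K + K ** ?R)"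
    using assms unfolding is_SLD_def by (metis vector_derivative_unique_at)
  then have eq: "?R ** L + L ** ?R = ?R ** K + K ** ?R"
    by simp
  have key: "trace (?R ** (M ** L)) + trace (?R ** (L ** M)) =
      trace (?R ** (M ** K)) + trace (?R ** (K ** M))" for M :: "'i oper"
  proof -
    have sym: "trace (?R ** (M ** X)) + trace (?R ** (X ** M)) = trace ((?R ** X + X ** ?R) ** M)"
      for X :: "'i oper"
    proof -
      have "trace (?R ** (M ** X)) = trace (X ** (?R ** M))"
        by (metis matrix_mul_assoc trace_mul_sym)
      then show ?thesis
        by (simp add: matrix_matrix_add_right_distrib trace_add matrix_mul_assoc)
    qed
    show ?thesis
      unfolding sym eq ..
  qed
  show ?thesis
    using key[of L] key[of K] by (simp add: add.commute flip: mult_2)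
qed

lemma quantum_fisher_eq:
  assumes "is_SLD \<rho> \<theta> L"
  shows "quantum_fisher \<rho> \<theta> = Re (trace (\<rho> \<theta> ** (L ** L)))"
  unfolding quantum_fisher_def Let_def
  using SLD_trace_unique[OF someI[of "is_SLD \<rho> \<theta>", OF assms] assms] by simp

end

theory Submission imports Defs begin

text \<open>
  Both algorithms rotate a state in a real plane spanned by two orthonormal kets \<open>a\<close>, \<open>b\<close> by the
  angle \<open>2\<theta>\<close> per step, so both families are \<open>cos (N\<theta>) a + sin (N\<theta>) b\<close>. The measurement distinguishes
  \<open>a\<close> from \<open>b\<close>, with probabilities \<open>cos\<^sup>2 (N\<theta>)\<close> and \<open>sin\<^sup>2 (N\<theta>)\<close>, whose Fisher terms
  \<open>4N\<^sup>2 sin\<^sup>2 (N\<theta>)\<close> and \<open>4N\<^sup>2 cos\<^sup>2 (N\<theta>)\<close> extend continuously to the zeros of the probabilities. For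
  the quantum Fisher information, differentiating \<open>\<rho>\<^sup>2 = \<rho>\<close> shows that \<open>2 \<rho>'\<close> is a symmetric
  logarithmic derivative.
\<close>

section \<open>Inner products, tensor products and operators acting on kets\<close>

text \<open>This is <u|v>, antilinear in the first argument; the real inner product of
  \<open>complex ^ 'i\<close> is its real part.\<close>

definition cdot :: "('i::finite) ket \<Rightarrow> 'i ket \<Rightarrow> complex" where
  "cdot u v = (\<Sum>i\<in>UNIV. cnj (u $ i) * v $ i)"

lemma cdot_linear [simp]:
  "cdot (u + v) w = cdot u w + cdot v w" "cdot w (u + v) = cdot w u + cdot w v"
  "cdot (u - v) w = cdot u w - cdot v w" "cdot w (u - v) = cdot w u - cdot w v"
  "cdot (r *\<^sub>R u) w = of_real r * cdot u w" "cdot w (r *\<^sub>R u) = of_real r * cdot w u"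
  "cdot (- u) w = - cdot u w" "cdot w (- u) = - cdot w u"
  "cdot 0 w = 0" "cdot w 0 = 0"
  by (simp_all add: cdot_def sum.distrib sum_subtractf sum_negf algebra_simps sum_distrib_left
      scaleR_conv_of_real[where 'a=complex])

lemma cdot_scale [simp]: "cdot w (c *s u) = c * cdot w u"
  by (simp add: cdot_def sum_distrib_left algebra_simps)

lemma cnj_cdot: "cnj (cdot u v) = cdot v u"
  by (simp add: cdot_def mult.commute)

lemma cdot_self: "cdot u u = of_real ((norm u)\<^sup>2)"
  by (simp add: cdot_def norm_vec_def L2_set_def sum_nonneg complex_norm_square mult.commute
      del: of_real_power)

lemma cdot_adj: "cdot u (M *v v) = cdot (adj M *v u) v"
proof -
  have "cdot u (M *v v) = (\<Sum>i\<in>UNIV. \<Sum>j\<in>UNIV. cnj (u $ i) * (M $ i $ j * v $ j))"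
    by (simp add: cdot_def matrix_vector_mult_def sum_distrib_left)
  also have "\<dots> = (\<Sum>j\<in>UNIV. \<Sum>i\<in>UNIV. cnj (u $ i) * (M $ i $ j * v $ j))"
    by (rule sum.swap)
  also have "\<dots> = cdot (adj M *v u) v"
    by (simp add: cdot_def matrix_vector_mult_def adj_def sum_distrib_left sum_distrib_right mult_ac)
  finally show ?thesis .
qed

lemma cdot_tensor_ket: "cdot (u \<otimes>\<^sub>k v) (w \<otimes>\<^sub>k z) = cdot u w * cdot v z"
  by (simp add: cdot_def tensor_ket_def sum_product UNIV_Times_UNIV[symmetric]
      sum.cartesian_product mult_ac case_prod_beta del: UNIV_Times_UNIV)

lemma cdot_ket: "cdot (ket i) (ket j) = (if i = j then 1 else 0)"
proof -
  have "cdot (ket i) (ket j) = (\<Sum>k\<in>UNIV. if k = i then (if i = j then 1 else 0) else 0)"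
    unfolding cdot_def ket_def axis_def by (rule sum.cong) auto
  then show ?thesis by simp
qed

lemma matrix_vector_scaleR:
  fixes M :: "('i::finite) oper"
  shows "M *v (r *\<^sub>R u) = r *\<^sub>R (M *v u)"
  by (simp add: matrix_vector_mult_def vec_eq_iff scaleR_sum_right)

lemma scaleR_matrix_vector:
  fixes M :: "('i::finite) oper"
  shows "(r *\<^sub>R M) *v u = r *\<^sub>R (M *v u)"
  by (simp add: matrix_vector_mult_def vec_eq_iff scaleR_sum_right)

lemma uminus_matrix_vector:
  fixes M :: "('i::finite) oper"
  shows "(- M) *v u = - (M *v u)"
  by (simp add: matrix_vector_mult_def vec_eq_iff sum_negf)

lemmas oper_linear = matrix_vector_scaleR scaleR_matrix_vector uminus_matrix_vector
  matrix_vector_right_distrib matrix_vector_mult_diff_distrib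
  matrix_vector_mult_add_rdistrib matrix_vector_mult_diff_rdistrib

lemma ketbra_mult_vec: "ketbra u v *v w = cdot v w *s u"
  by (simp add: ketbra_def cdot_def matrix_vector_mult_def vec_eq_iff sum_distrib_left sum_distrib_right mult_ac)

text \<open>For \<open>u = v\<close> this turns outcome probabilities and Tr(rho L^2) into
  expectation values <u|M|u>.\<close>

lemma trace_ketbra_mult: "trace (ketbra u v ** M) = cdot v (M *v u)"
proof -
  have "trace (ketbra u v ** M) = (\<Sum>i\<in>UNIV. \<Sum>j\<in>UNIV. u $ i * cnj (v $ j) * M $ j $ i)"
    by (simp add: trace_def ketbra_def matrix_matrix_mult_def)
  also have "\<dots> = (\<Sum>j\<in>UNIV. \<Sum>i\<in>UNIV. u $ i * cnj (v $ j) * M $ j $ i)"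
    by (rule sum.swap)
  also have "\<dots> = cdot v (M *v u)"
    by (simp add: cdot_def matrix_vector_mult_def sum_distrib_left mult_ac)
  finally show ?thesis .
qed

lemma tensor_op_mult_vec: "(M \<otimes>\<^sub>o K) *v (u \<otimes>\<^sub>k v) = (M *v u) \<otimes>\<^sub>k (K *v v)"
  by (simp add: tensor_op_def tensor_ket_def matrix_vector_mult_def vec_eq_iff sum_product
      UNIV_Times_UNIV[symmetric] sum.cartesian_product mult_ac case_prod_beta
      del: UNIV_Times_UNIV)

lemma tensor_ket_zero_right: "u \<otimes>\<^sub>k 0 = 0"
  by (simp add: tensor_ket_def vec_eq_iff)

section \<open>Quantum Fisher information of a rotation in a real plane\<close>

text \<open>Over the reals the antilinear slot is linear too, and in finite dimension bilinear maps
  are bounded. This provides the product rule for |u><u|.\<close>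

lemma bounded_bilinear_ketbra: "bounded_bilinear (ketbra :: ('i::finite) ket \<Rightarrow> _)"
  unfolding bilinear_conv_bounded_bilinear[symmetric] bilinear_def
  by (auto intro!: linearI simp: ketbra_def vec_eq_iff algebra_simps)

text \<open>The curve \<open>u\<close> has velocity \<open>N v\<close>, with \<open>v\<close> the
  unit ket a quarter turn ahead of \<open>u \<theta>\<close> and orthogonal to it. Hence the
  derivative \<open>D\<close> of the density operator exchanges \<open>u \<theta>\<close> and
  \<open>v\<close> up to the factor \<open>N\<close>.\<close>

lemma quantum_fisher_rotation:
  fixes a b :: "('i::finite) ket"
  assumes aa: "cdot a a = 1" and bb: "cdot b b = 1" and ab: "cdot a b = 0"
  shows "quantum_fisher (\<lambda>t. density_op (cos (real N * t) *\<^sub>R a + sin (real N * t) *\<^sub>R b)) \<theta>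
    = 4 * (real N)\<^sup>2"
proof -
  define u where "u t = cos (real N * t) *\<^sub>R a + sin (real N * t) *\<^sub>R b" for t
  define v where "v = - sin (real N * \<theta>) *\<^sub>R a + cos (real N * \<theta>) *\<^sub>R b"
  define D where "D = real N *\<^sub>R (ketbra (u \<theta>) v + ketbra v (u \<theta>))"
  have ba: "cdot b a = 0"
    using cnj_cdot[of a b] ab by simp
  have cs: "(complex_of_real (cos x))\<^sup>2 + (complex_of_real (sin x))\<^sup>2 = 1" for x
    by (metis of_real_1 of_real_add of_real_power sin_cos_squared_add2)
  have uu: "cdot (u \<theta>) (u \<theta>) = 1" and vv: "cdot v v = 1"
    and uv: "cdot (u \<theta>) v = 0" and vu: "cdot v (u \<theta>) = 0"
    unfolding u_def v_def
    by (simp_all add: aa bb ab ba cs power2_eq_square[symmetric] add.commute)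
  have du: "(u has_vector_derivative real N *\<^sub>R v) (at \<theta>)"
    unfolding u_def v_def
    by (auto intro!: derivative_eq_intros simp: algebra_simps)
  have D: "((\<lambda>t. density_op (u t)) has_vector_derivative D) (at \<theta>)"
    unfolding density_op_def D_def
    using bounded_bilinear.has_vector_derivative[OF bounded_bilinear_ketbra du du]
    by (simp add: scaleR_right_distrib
        bounded_bilinear.scaleR_left[OF bounded_bilinear_ketbra]
        bounded_bilinear.scaleR_right[OF bounded_bilinear_ketbra])
  have Dvec: "D *v w = of_real (real N) *s (cdot v w *s u \<theta> + cdot (u \<theta>) w *s v)" for w
    by (simp add: D_def oper_linear ketbra_mult_vec vec_eq_iff distrib_left
        scaleR_conv_of_real[where 'a=complex])
  have SLD: "is_SLD (\<lambda>t. density_op (u t)) \<theta> (2 *\<^sub>R D)"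
    unfolding is_SLD_def
  proof
    show "hermitian (2 *\<^sub>R D)"
      by (simp add: hermitian_def adj_def D_def ketbra_def vec_eq_iff algebra_simps)
    \<comment> \<open>The identity rho' = rho rho' + rho' rho is checked on every ket, using only
      that \<open>u \<theta>\<close> is a unit ket orthogonal to \<open>v\<close>.\<close>
    have "(1/2) *\<^sub>R (density_op (u \<theta>) ** (2 *\<^sub>R D) + (2 *\<^sub>R D) ** density_op (u \<theta>)) = D"
    proof (subst matrix_eq, intro allI)
      fix w
      show "((1/2) *\<^sub>R (density_op (u \<theta>) ** (2 *\<^sub>R D) + (2 *\<^sub>R D) ** density_op (u \<theta>))) *v w = D *v w"
        by (simp add: oper_linear Dvec density_op_def ketbra_mult_vec uu uv vu
            matrix_vector_mul_assoc[symmetric] vec_eq_iff scaleR_conv_of_real[where 'a=complex] algebra_simps)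
    qed
    then show "((\<lambda>t. density_op (u t)) has_vector_derivative
        (1/2) *\<^sub>R (density_op (u \<theta>) ** (2 *\<^sub>R D) + (2 *\<^sub>R D) ** density_op (u \<theta>))) (at \<theta>)"
      using D by simp
  qed
  \<comment> \<open>The trace is 4 <u|D D|u>, and \<open>D\<close> sends \<open>u \<theta>\<close>
    to \<open>N v\<close> and \<open>v\<close> back to \<open>N u \<theta>\<close>.\<close>
  have "trace (density_op (u \<theta>) ** ((2 *\<^sub>R D) ** (2 *\<^sub>R D))) = 4 * of_nat N * of_nat N"
    by (simp add: density_op_def trace_ketbra_mult matrix_vector_mul_assoc[symmetric] oper_linear
        Dvec uu uv vu vv)
  then show ?thesis
    using quantum_fisher_eq[OF SLD] by (simp add: u_def power2_eq_square)
qed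

section \<open>Classical Fisher information of a rotation in a real plane\<close>

text \<open>
  Stated for a sine with a phase, which also covers the cosine. For \<open>k = 0\<close> and \<open>sin c = 0\<close> the
  probability vanishes identically, \<open>ln 0\<close> is a constant and the term is \<open>0\<close>.
\<close>

lemma fisher_term_sin_squared:
  "fisher_term (\<lambda>t. (sin (k * t + c))\<^sup>2) \<theta> = 4 * k\<^sup>2 * (cos (k * \<theta> + c))\<^sup>2"
proof -
  let ?p = "\<lambda>t::real. (sin (k * t + c))\<^sup>2"
  let ?g = "\<lambda>t::real. 4 * k\<^sup>2 * (cos (k * t + c))\<^sup>2"
  have expr: "fisher_expr ?p t = ?g t" if "sin (k * t + c) \<noteq> 0" for t
  proof -
    have "((\<lambda>t. ln (?p t)) has_real_derivative 2 * k * cos (k * t + c) / sin (k * t + c)) (at t)"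
      using that by (auto intro!: derivative_eq_intros simp: power2_eq_square field_simps
          zero_less_mult_iff linorder_neq_iff)
    then show ?thesis
      using that by (simp add: fisher_expr_def DERIV_imp_deriv power_divide power_mult_distrib)
  qed
  show ?thesis
  proof (cases "sin (k * \<theta> + c) = 0")
    case False
    then show ?thesis by (simp add: fisher_term_def expr)
  next
    case True
    have lim: "(fisher_expr ?p \<longlongrightarrow> ?g \<theta>) (at \<theta>)"
    proof (cases "k = 0")
      case k: True
      then show ?thesis by (simp add: fisher_expr_def[abs_def])
    next
      case k: False
      let ?s = "\<lambda>t::real. sin (k * t + c)"
      have c0: "cos (k * \<theta> + c) \<noteq> 0"
        using True sin_cos_squared_add[of "k * \<theta> + c"] by auto
      \<comment> \<open>The zero at \<open>\<theta>\<close> is simple, hence isolated: near it the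
        difference quotient is nonzero, so \<open>expr\<close> applies on a punctured
        neighbourhood.\<close>
      have "(?s has_real_derivative k * cos (k * \<theta> + c)) (at \<theta>)"
        by (auto intro!: derivative_eq_intros)
      then have "((\<lambda>t. (?s t - ?s \<theta>) / (t - \<theta>)) \<longlongrightarrow> k * cos (k * \<theta> + c)) (at \<theta>)"
        by (simp add: has_field_derivative_iff)
      then have "\<forall>\<^sub>F t in at \<theta>. (?s t - ?s \<theta>) / (t - \<theta>) \<noteq> 0"
        by (rule tendsto_imp_eventually_ne) (simp add: k c0)
      then have ev: "\<forall>\<^sub>F t in at \<theta>. ?g t = fisher_expr ?p t"
        by eventually_elim (use True expr in auto)
      have "(?g \<longlongrightarrow> ?g \<theta>) (at \<theta>)"
        by (intro tendsto_intros)
      then show ?thesis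
        using tendsto_cong[OF ev] by blast
    qed
    show ?thesis
      using True tendsto_Lim[OF _ lim] by (simp add: fisher_term_def)
  qed
qed

text \<open>The probabilities see \<open>E\<close> only on the plane of \<open>a\<close> and
  \<open>b\<close>, so prescribing it there covers both measurements, whatever the ranks of their
  projectors. The two Fisher terms add up by sin^2 + cos^2 = 1.\<close>

lemma classical_fisher_rotation:
  fixes a b :: "('i::finite) ket" and E :: "bool \<Rightarrow> 'i oper"
  assumes aa: "cdot a a = 1" and bb: "cdot b b = 1" and ab: "cdot a b = 0"
    and E: "E False *v a = a" "E False *v b = 0" "E True *v a = 0" "E True *v b = b"
  shows "classical_fisher (\<lambda>t. density_op (cos (real N * t) *\<^sub>R a + sin (real N * t) *\<^sub>R b)) E \<theta>
    = 4 * (real N)\<^sup>2"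
proof -
  let ?\<rho> = "\<lambda>t. density_op (cos (real N * t) *\<^sub>R a + sin (real N * t) *\<^sub>R b)"
  have ba: "cdot b a = 0"
    using cnj_cdot[of a b] ab by simp
  have "outcome_prob ?\<rho> (E False) = (\<lambda>t. (cos (real N * t))\<^sup>2)"
    by (simp add: fun_eq_iff outcome_prob_def density_op_def trace_ketbra_mult oper_linear E aa ba
        power2_eq_square)
  \<comment> \<open>The cosine becomes a sine with phase pi/2; below, the sine gets phase 0 to match
    the same form.\<close>
  then have "outcome_prob ?\<rho> (E False) = (\<lambda>t. (sin (real N * t + pi / 2))\<^sup>2)"
    by (simp add: sin_add)
  then have "fisher_term (outcome_prob ?\<rho> (E False)) \<theta> = 4 * (real N)\<^sup>2 * (sin (real N * \<theta>))\<^sup>2"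
    by (simp add: fisher_term_sin_squared cos_add)
  moreover have "outcome_prob ?\<rho> (E True) = (\<lambda>t. (sin (real N * t + 0))\<^sup>2)"
    by (simp add: fun_eq_iff outcome_prob_def density_op_def trace_ketbra_mult oper_linear E bb ab
        power2_eq_square)
  then have "fisher_term (outcome_prob ?\<rho> (E True)) \<theta> = 4 * (real N)\<^sup>2 * (cos (real N * \<theta>))\<^sup>2"
    by (simp only: fisher_term_sin_squared) simp
  ultimately show ?thesis
    by (simp add: classical_fisher_def UNIV_bool distrib_left[symmetric])
qed

section \<open>The Grover operators as rotations by twice the angle\<close>

lemma rotation_iterate:
  fixes a b :: "('i::finite) ket"
  assumes "\<And>x. M *v (cos x *\<^sub>R a + sin x *\<^sub>R b) = cos (x + \<delta>) *\<^sub>R a + sin (x + \<delta>) *\<^sub>R b"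
  shows "((*v) M ^^ m) (cos x *\<^sub>R a + sin x *\<^sub>R b)
    = cos (x + real m * \<delta>) *\<^sub>R a + sin (x + real m * \<delta>) *\<^sub>R b"
proof (induction m)
  case (Suc m)
  then show ?case
    using assms[of "x + real m * \<delta>"] by (simp add: distrib_right add_ac)
qed simp

text \<open>With \<open>sin_shift\<close>, these are the coordinates of the unit vector at angle -x
  reflected in the line at angle t, which lands at angle x + 2t.\<close>

lemma cos_shift: "2 * cos (x + t) * cos t - cos x = cos (x + 2 * t)" for x t :: real
  using cos_times_cos[of "x + t" t] by (simp add: algebra_simps)

lemma sin_shift: "2 * cos (x + t) * sin t + sin x = sin (x + 2 * t)" for x t :: real
  using cos_times_sin[of "x + t" t] by (simp add: algebra_simps)

lemma of_real_vector_scale: "complex_of_real r *s u = r *\<^sub>R u"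
  by (simp add: vec_eq_iff scaleR_conv_of_real[where 'a=complex])

lemma U0_mult_vec: "U0 *v w = 2 *\<^sub>R (cdot ket_zero w *s ket_zero) - w"
  by (simp add: U0_def oper_linear ketbra_mult_vec)

lemma E_G_mult_vec: "E_G b *v (u \<otimes>\<^sub>k ket c) = (if b = c then u \<otimes>\<^sub>k ket c else 0)"
  by (auto simp: E_G_def tensor_op_mult_vec ketbra_mult_vec cdot_ket tensor_ket_zero_right)

lemma Uf_mult_vec:
  fixes u :: "('n::finite) reg ket"
  shows "Uf *v (u \<otimes>\<^sub>k ket c) = (if c then - (u \<otimes>\<^sub>k ket c) else u \<otimes>\<^sub>k ket c)"
proof -
  \<comment> \<open>\<open>Uf\<close> is the reflection that fixes the range of the projector
    \<open>E_G False\<close>.\<close>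
  have "Uf *v w = 2 *\<^sub>R (E_G False *v w) - w" for w :: "'n reg1 ket"
    unfolding Uf_def E_G_def oper_linear by simp
  then show ?thesis
    by (simp add: E_G_mult_vec scaleR_2)
qed

theorem mainTheorem2:
  fixes A :: "('n::finite) reg1 oper"
    and \<psi>0 \<psi>1 :: "'n reg ket"
    and \<phi> :: "'n reg1 ket"
    and \<theta> :: real and N :: nat
  assumes "unitary A"
    and "norm \<psi>0 = 1" and "norm \<psi>1 = 1"
    and "A *v ket_zero = cos \<theta> *\<^sub>R (\<psi>0 \<otimes>\<^sub>k ket False) + sin \<theta> *\<^sub>R (\<psi>1 \<otimes>\<^sub>k ket True)"
    and "\<phi> = adj A *v (- sin \<theta> *\<^sub>R (\<psi>0 \<otimes>\<^sub>k ket False) + cos \<theta> *\<^sub>R (\<psi>1 \<otimes>\<^sub>k ket True))"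
  shows "(\<forall>m. psi_G \<psi>0 \<psi>1 (2 * m + 1) \<theta> = (((*v) (grover_G A)) ^^ m) (A *v ket_zero)) \<and>
    (\<forall>m. psi_Q \<phi> (2 * m) \<theta> = (((*v) (grover_Q A)) ^^ m) ket_zero) \<and>
    classical_fisher (\<lambda>t. density_op (psi_G \<psi>0 \<psi>1 N t)) E_G \<theta> = 4 * (real N)\<^sup>2 \<and>
    quantum_fisher (\<lambda>t. density_op (psi_G \<psi>0 \<psi>1 N t)) \<theta> = 4 * (real N)\<^sup>2 \<and>
    classical_fisher (\<lambda>t. density_op (psi_Q \<phi> N t)) E_Q \<theta> = 4 * (real N)\<^sup>2 \<and>
    quantum_fisher (\<lambda>t. density_op (psi_Q \<phi> N t)) \<theta> = 4 * (real N)\<^sup>2"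
proof -
  define a where "a = \<psi>0 \<otimes>\<^sub>k ket False"
  define b where "b = \<psi>1 \<otimes>\<^sub>k ket True"
  \<comment> \<open>\<open>s'\<close> is \<open>A *v ket_zero\<close> turned by a quarter turn in
    the plane of \<open>a\<close> and \<open>b\<close>; \<open>\<phi>\<close> is its preimage under
    \<open>A\<close>.\<close>
  define s' where "s' = - sin \<theta> *\<^sub>R a + cos \<theta> *\<^sub>R b"
  have aa: "cdot a a = 1" and bb: "cdot b b = 1" and ab: "cdot a b = 0" and ba: "cdot b a = 0"
    using assms(2,3) cdot_self[of \<psi>0] cdot_self[of \<psi>1]
    by (simp_all add: a_def b_def cdot_tensor_ket cdot_ket)
  have Ua: "adj A *v (A *v w) = w" and Ub: "A *v (adj A *v w) = w" for w
    using assms(1) by (simp_all add: unitary_def matrix_vector_mul_assoc)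
  have Az: "A *v ket_zero = cos \<theta> *\<^sub>R a + sin \<theta> *\<^sub>R b"
    and \<phi>: "\<phi> = adj A *v s'"
    using assms(4,5) by (simp_all add: a_def b_def s'_def)
  have A\<phi>: "A *v \<phi> = s'"
    by (simp add: \<phi> Ub)
  \<comment> \<open>Unitarity transfers orthonormality from \<open>A *v ket_zero\<close> and
    \<open>s'\<close> to \<open>ket_zero\<close> and \<open>\<phi>\<close>.\<close>
  have cdot_A: "cdot u w = cdot (A *v u) (A *v w)" for u w
    by (simp add: cdot_adj Ua)
  have cs: "(complex_of_real (cos x))\<^sup>2 + (complex_of_real (sin x))\<^sup>2 = 1" for x
    by (metis of_real_1 of_real_add of_real_power sin_cos_squared_add2)
  have zz: "cdot ket_zero (ket_zero :: 'n reg1 ket) = 1"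
    by (simp add: ket_zero_def cdot_ket)
  have \<phi>\<phi>: "cdot \<phi> \<phi> = 1" and z\<phi>: "cdot ket_zero \<phi> = 0"
    by (simp_all add: cdot_A[of \<phi> \<phi>] cdot_A[of ket_zero \<phi>] A\<phi> Az s'_def aa bb ab ba cs
        power2_eq_square[symmetric] add.commute)
  have Ufa: "Uf *v a = a" and Ufb: "Uf *v b = - b"
    by (simp_all add: a_def b_def Uf_mult_vec)

  have G: "grover_G A *v (cos x *\<^sub>R a + sin x *\<^sub>R b)
      = cos (x + 2 * \<theta>) *\<^sub>R a + sin (x + 2 * \<theta>) *\<^sub>R b" for x
  proof -
    \<comment> \<open>\<open>?w\<close> is the image under \<open>Uf\<close>, at angle -x. The
      remaining factors reflect in the line of \<open>A *v ket_zero\<close>, at angle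
      \<open>\<theta>\<close>, so the two reflections compose to a rotation by twice
      \<open>\<theta>\<close>.\<close>
    let ?w = "cos x *\<^sub>R a - sin x *\<^sub>R b"
    have ip: "cdot ket_zero (adj A *v ?w) = of_real (cos (x + \<theta>))"
      by (simp add: cdot_A[of ket_zero] Ub Az aa bb ab ba cos_add)
    have "grover_G A *v (cos x *\<^sub>R a + sin x *\<^sub>R b)
        = A *v (U0 *v (adj A *v ?w))"
      by (simp add: grover_G_def matrix_vector_mul_assoc[symmetric])
        (simp add: oper_linear Ufa Ufb)
    also have "\<dots> = A *v ((2 * cos (x + \<theta>)) *\<^sub>R ket_zero - adj A *v ?w)"
      by (simp only: U0_mult_vec ip of_real_vector_scale scaleR_scaleR)
    also have "\<dots> = (2 * cos (x + \<theta>)) *\<^sub>R (cos \<theta> *\<^sub>R a + sin \<theta> *\<^sub>R b) - ?w"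
      by (simp only: oper_linear(1,5) Ub Az)
    also have "\<dots> = (2 * cos (x + \<theta>) * cos \<theta> - cos x) *\<^sub>R a
        + (2 * cos (x + \<theta>) * sin \<theta> + sin x) *\<^sub>R b"
      by (simp add: algebra_simps)
    finally show ?thesis
      by (simp only: cos_shift sin_shift)
  qed

  have Q: "grover_Q A *v (cos x *\<^sub>R ket_zero + sin x *\<^sub>R \<phi>)
      = cos (x + 2 * \<theta>) *\<^sub>R ket_zero + sin (x + 2 * \<theta>) *\<^sub>R \<phi>" for x
  proof -
    \<comment> \<open>Relative to \<open>ket_zero\<close> and \<open>\<phi>\<close> the angle x
      becomes x + \<open>\<theta>\<close> in the frame \<open>a\<close>, \<open>b\<close>.
      \<open>Uf\<close> negates it, returning to the old frame subtracts \<open>\<theta>\<close> and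
      gives -\<open>?y\<close>, and \<open>U0\<close> flips the sign of
      \<open>\<phi>\<close>.\<close>
    let ?y = "x + 2 * \<theta>"
    have y: "cos (x + \<theta>) = cos (?y - \<theta>)" "sin (x + \<theta>) = sin (?y - \<theta>)"
      by (simp_all add: algebra_simps)
    have "A *v (cos x *\<^sub>R ket_zero + sin x *\<^sub>R \<phi>) = cos (x + \<theta>) *\<^sub>R a + sin (x + \<theta>) *\<^sub>R b"
      by (simp add: oper_linear Az A\<phi> s'_def cos_add sin_add algebra_simps)
    then have "Uf *v (A *v (cos x *\<^sub>R ket_zero + sin x *\<^sub>R \<phi>))
        = cos (x + \<theta>) *\<^sub>R a - sin (x + \<theta>) *\<^sub>R b"
      by (simp add: oper_linear Ufa Ufb)
    also have "\<dots> = cos ?y *\<^sub>R (A *v ket_zero) - sin ?y *\<^sub>R (A *v \<phi>)"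
      unfolding y cos_diff[of ?y] sin_diff[of ?y] Az A\<phi> s'_def by (simp add: algebra_simps)
    finally have "adj A *v (Uf *v (A *v (cos x *\<^sub>R ket_zero + sin x *\<^sub>R \<phi>)))
        = cos ?y *\<^sub>R ket_zero - sin ?y *\<^sub>R \<phi>"
      by (simp only: oper_linear(1,5) Ua)
    then have "grover_Q A *v (cos x *\<^sub>R ket_zero + sin x *\<^sub>R \<phi>)
        = U0 *v (cos ?y *\<^sub>R ket_zero - sin ?y *\<^sub>R \<phi>)"
      by (simp only: grover_Q_def matrix_vector_mul_assoc[symmetric])
    also have "\<dots> = cos ?y *\<^sub>R ket_zero + sin ?y *\<^sub>R \<phi>"
      by (simp add: U0_mult_vec zz z\<phi> vec_eq_iff scaleR_conv_of_real[where 'a=complex])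
    finally show ?thesis .
  qed

  \<comment> \<open>The iteration of G starts from \<open>A *v ket_zero\<close> at angle
    \<open>\<theta>\<close>, whence odd multiples; that of Q starts from \<open>ket_zero\<close> at
    angle 0, whence even ones.\<close>
  have "\<forall>m. psi_G \<psi>0 \<psi>1 (2 * m + 1) \<theta> = ((*v) (grover_G A) ^^ m) (A *v ket_zero)"
    unfolding Az rotation_iterate[OF G] by (simp add: psi_G_def a_def b_def algebra_simps)
  moreover have "\<forall>m. psi_Q \<phi> (2 * m) \<theta> = ((*v) (grover_Q A) ^^ m) ket_zero"
    using rotation_iterate[OF Q, of _ 0] by (simp add: psi_Q_def algebra_simps)
  moreover have "E_G False *v a = a" "E_G False *v b = 0" "E_G True *v a = 0" "E_G True *v b = b"
    by (simp_all add: a_def b_def E_G_mult_vec)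
  note classical_fisher_rotation[OF aa bb ab this]
  moreover have "E_Q False *v ket_zero = (ket_zero :: 'n reg1 ket)" "E_Q False *v \<phi> = 0"
      "E_Q True *v (ket_zero :: 'n reg1 ket) = 0" "E_Q True *v \<phi> = \<phi>"
    by (simp_all add: E_Q_def oper_linear ketbra_mult_vec zz z\<phi>)
  note classical_fisher_rotation[OF zz \<phi>\<phi> z\<phi> this]
  moreover note quantum_fisher_rotation[OF aa bb ab] quantum_fisher_rotation[OF zz \<phi>\<phi> z\<phi>]
  ultimately show ?thesis
    by (simp add: psi_G_def psi_Q_def a_def b_def)
qed

end
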